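(* Let $\alpha,\beta,\gamma$ be real numbers with $\alpha\ge 1$, $\gamma\ge 1$, $\beta>0$ and $\alpha+\beta\ge 4$, and let $$\mathbb{F}_{\alpha,\beta}^{\gamma}(z)=z[\Gamma(\beta)]^{\gamma}\sum_{n=0}^{\infty}\frac{z^{n}}{[\Gamma(\alpha n+\beta)]^{\gamma}}$$ be the normalized Le Roy type function. Then $\mathbb{F}_{\alpha,\beta}^{\gamma}$ is exponentially starlike in $\mathcal{D}=\{z\in\mathbb{C}:|z|<1\}$ if $$(2e-1)[\Gamma(\beta)]^{\gamma}<[\Gamma(\alpha+\beta)]^{\gamma},$$ and it is exponentially convex in $\mathcal{D}$ if $$(4e^{2}-4e+2)[\Gamma(\beta)]^{\gamma}<(e-1)[\Gamma(\alpha+\beta)]^{\gamma}.$$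
   Context: $\Gamma$ is the Euler gamma function. $\mathcal{A}$ is the class of analytic functions $f$ on $\mathcal{D}$ with $f(0)=f'(0)-1=0$. Subordination: an analytic function $p$ on $\mathcal{D}$ is subordinate to an analytic univalent function $g$ on $\mathcal{D}$ if there exists an analytic function $w$ on $\mathcal{D}$ with $w(0)=0$ and $|w(z)|\le|z|<1$ such that $p(z)=g(w(z))$ for all $z\in\mathcal{D}$ (equivalently, $p(0)=g(0)$ and $p(\mathcal{D})\subset g(\mathcal{D})$). $P_e$ is the class of analytic functions $p$ on $\mathcal{D}$ with $p(0)=1$ that are subordinate to $e^{z}$ on $\mathcal{D}$. A function $f\in\mathcal{A}$ is exponentially starlike in $\mathcal{D}$ if $\frac{zf'(z)}{f(z)}$ belongs to $P_e$, and exponentially convex in $\mathcal{D}$ if $1+\frac{zf''(z)}{f'(z)}$ belongs to $P_e$ (the quotient $zf'(z)/f(z)$ is understood to take the value $1$ at $z=0$). *)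

theory Defs
  imports "HOL-Complex_Analysis.Complex_Analysis"
begin

abbreviation unit_disc :: "complex set" where
  "unit_disc \<equiv> ball 0 1"

definition class_A :: "(complex \<Rightarrow> complex) set" where
  "class_A = {f. f holomorphic_on unit_disc \<and> f 0 = 0 \<and> deriv f 0 - 1 = 0}"

definition subordinate :: "(complex \<Rightarrow> complex) \<Rightarrow> (complex \<Rightarrow> complex) \<Rightarrow> bool" where
  "subordinate p g \<longleftrightarrow>
     p holomorphic_on unit_disc \<and> g holomorphic_on unit_disc \<and> inj_on g unit_disc \<and>
     (\<exists>w. w holomorphic_on unit_disc \<and> w 0 = 0 \<and>
          (\<forall>z\<in>unit_disc. norm (w z) \<le> norm z) \<and>
          (\<forall>z\<in>unit_disc. p z = g (w z)))"

definition class_P_e :: "(complex \<Rightarrow> complex) set" where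
  "class_P_e = {p. p holomorphic_on unit_disc \<and> p 0 = 1 \<and> subordinate p exp}"

text \<open>
  Since \<open>x / 0 = 0\<close>, the next two definitions state explicitly that the denominators of the
  quotients do not vanish. This is implicit in calling the quotients analytic functions on
  the disc: a zero of \<open>f\<close> (other than the origin) or of \<open>f'\<close> would be a pole of the
  corresponding quotient. At the origin \<open>z f' / f\<close> takes its limit value \<open>1\<close>.
\<close>

definition exponentially_starlike :: "(complex \<Rightarrow> complex) \<Rightarrow> bool" where
  "exponentially_starlike f \<longleftrightarrow>
     f \<in> class_A \<and> (\<forall>z\<in>unit_disc - {0}. f z \<noteq> 0) \<and>
     (\<lambda>z. if z = 0 then 1 else z * deriv f z / f z) \<in> class_P_e"

definition exponentially_convex :: "(complex \<Rightarrow> complex) \<Rightarrow> bool" where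
  "exponentially_convex f \<longleftrightarrow>
     f \<in> class_A \<and> (\<forall>z\<in>unit_disc. deriv f z \<noteq> 0) \<and>
     (\<lambda>z. 1 + z * deriv (deriv f) z / deriv f z) \<in> class_P_e"

text \<open>
  For \<open>\<alpha> \<ge> 0\<close> and \<open>\<beta> > 0\<close> all Gamma values below are positive, so \<open>powr\<close> is the
  ordinary real power.
\<close>

definition le_roy :: "real \<Rightarrow> real \<Rightarrow> real \<Rightarrow> complex \<Rightarrow> complex" where
  "le_roy \<alpha> \<beta> \<gamma> z =
     z * of_real (Gamma \<beta> powr \<gamma>) *
     (\<Sum>n. z ^ n / of_real (Gamma (\<alpha> * real n + \<beta>) powr \<gamma>))"

end

theory Submission
  imports Defs
begin

text \<open>
  The disc of radius \<open>1 - 1/e\<close> about \<open>1\<close> lies in the image of the unit disc under \<open>exp\<close>, because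
  \<open>\<bar>Ln (1 + u)\<bar> \<le> - ln (1 - \<bar>u\<bar>)\<close>. So a function with value \<open>1\<close> at the origin that stays in that
  disc has a logarithm mapping the unit disc into itself, the Schwarz lemma turns this logarithm
  into the inner function of a subordination to \<open>exp\<close> (\<open>class_P_eI\<close>).

  Both quotients of the theorem have the form \<open>1 + z g'(z) / g(z)\<close> with \<open>g 0 = 1\<close>: if
  \<open>f(z) = z g(z)\<close>, then \<open>z f' / f = 1 + z g' / g\<close>, while the quotient for convexity uses \<open>f'\<close> in
  the place of \<open>g\<close>. For a power series \<open>g(z) = 1 + \<Sum> b\<^sub>n z\<^sup>n\<close>, the triangle inequality in numerator
  and denominator gives \<open>\<bar>z g' / g\<bar> < \<delta>\<close> with \<open>\<delta> = 1 - 1/e\<close> as soon as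
  \<open>\<Sum> (n + \<delta>) \<bar>b\<^sub>n\<bar> \<le> \<delta>\<close> (\<open>one_plus_log_derivative_in_class_P_e\<close>).

  For the Le Roy type function, \<open>g\<close> has the coefficients
  \<open>a\<^sub>n = (\<Gamma>(\<beta>) / \<Gamma>(\<alpha> n + \<beta>))\<^sup>\<gamma>\<close>. Since \<open>\<alpha> \<ge> 1\<close>, \<open>\<gamma> \<ge> 1\<close> and \<open>\<alpha> + \<beta> \<ge> 4\<close>, the functional
  equation and the monotonicity of \<open>\<Gamma>\<close> give \<open>a\<^sub>n \<le> a\<^sub>1 / 4\<^sup>n\<^sup>-\<^sup>1\<close> for \<open>n \<ge> 1\<close>. The majorant of the
  coefficient sum is then an explicit multiple of \<open>a\<^sub>1\<close>, and each hypothesis of the theorem is an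
  upper bound for \<open>a\<^sub>1\<close> that makes it at most \<open>\<delta>\<close>. These last comparisons are quadratic inequalities
  in \<open>e\<close> that hold by \<open>e \<ge> 2.7\<close>.
\<close>

section \<open>A disc inside the image of the exponential function\<close>

text \<open>
  The coefficients of the logarithmic series are dominated in absolute value by those of
  \<open>- ln (1 - x)\<close>, which are positive.
\<close>

lemma norm_Ln_one_plus_le:
  fixes u :: complex
  assumes "norm u < 1"
  shows "norm (Ln (1 + u)) \<le> - ln (1 - norm u)"
proof -
  have S: "(\<lambda>n. - ((- u) ^ n) / of_nat n) sums Ln (1 + u)"
    using assms by (rule Ln_series')
  have T: "(\<lambda>n. norm u ^ n / real n) sums - ln (1 - norm u)"
    using sums_minus[OF ln_series'[of "- norm u"]] assms by simp
  have eq: "norm (- ((- u) ^ n) / of_nat n) = norm u ^ n / real n" for n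
    by (simp add: norm_divide norm_power)
  have "norm (\<Sum>n. - ((- u) ^ n) / of_nat n) \<le> (\<Sum>n. norm u ^ n / real n)"
    using summable_norm[of "\<lambda>n. - ((- u) ^ n) / of_nat n"] sums_summable[OF T]
    unfolding eq by blast
  then show ?thesis
    using sums_unique[OF S] sums_unique[OF T] by simp
qed

text \<open>
  The principal logarithm of \<open>p\<close> serves as the inner function of the subordination: the bound
  makes its modulus less than \<open>- ln (exp (-1)) = 1\<close>, so that the Schwarz lemma applies.
\<close>

lemma class_P_eI:
  assumes hol: "p holomorphic_on unit_disc" and p0: "p 0 = 1"
    and bound: "\<And>z. z \<in> unit_disc \<Longrightarrow> norm (p z - 1) < 1 - exp (-1)"
  shows "p \<in> class_P_e"
proof -
  define w where "w = (\<lambda>z. Ln (p z))"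
  have lt1: "norm (p z - 1) < 1" if "z \<in> unit_disc" for z
    using bound[OF that] exp_gt_zero[of "-1 :: real"] by linarith
  have notin: "p z \<notin> \<real>\<^sub>\<le>\<^sub>0" if "z \<in> unit_disc" for z
  proof -
    have "\<bar>Re (p z - 1)\<bar> < 1"
      using abs_Re_le_cmod[of "p z - 1"] lt1[OF that] by linarith
    then show ?thesis by (auto simp: complex_nonpos_Reals_iff)
  qed
  have holw: "w holomorphic_on unit_disc"
    unfolding w_def using hol notin by (intro holomorphic_intros) auto
  have w0: "w 0 = 0" by (simp add: w_def p0)
  have w_lt1: "norm (w z) < 1" if z: "z \<in> unit_disc" for z
  proof -
    have "norm (w z) \<le> - ln (1 - norm (p z - 1))"
      using norm_Ln_one_plus_le[OF lt1[OF z]] by (simp add: w_def)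
    also have "\<dots> < - ln (exp (-1))"
      using bound[OF z] lt1[OF z] by (subst neg_less_iff_less, subst ln_less_cancel_iff) auto
    finally show ?thesis by simp
  qed
  have pw: "p z = exp (w z)" if "z \<in> unit_disc" for z
    using notin[OF that] by (subst w_def, subst exp_Ln) auto
  have "norm (w z) \<le> norm z" if "z \<in> unit_disc" for z
    using that w_lt1 by (intro Schwarz_Lemma(1)[OF holw w0]) auto
  moreover have "inj_on (exp :: complex \<Rightarrow> complex) unit_disc"
    using inj_on_exp_pi[of 0] pi_gt3 by (rule_tac inj_on_subset) auto
  ultimately show ?thesis
    unfolding class_P_e_def subordinate_def
    using hol p0 holw w0 pw by (auto intro!: exI[of _ w] holomorphic_intros)
qed

section \<open>Coefficient conditions\<close>

lemma unit_disc_power_series: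
  fixes b :: "nat \<Rightarrow> complex"
  assumes g: "\<And>z. z \<in> unit_disc \<Longrightarrow> (\<lambda>n. b n * z ^ n) sums g z"
  shows "g holomorphic_on unit_disc"
    and "z \<in> unit_disc \<Longrightarrow> (g has_field_derivative deriv g z) (at z)"
    and "z \<in> unit_disc \<Longrightarrow> (\<lambda>n. diffs b n * z ^ n) sums deriv g z"
proof -
  show hol: "g holomorphic_on unit_disc"
    using g by (intro power_series_holomorphic[of 0 1 b g]) auto
  show deriv: "(g has_field_derivative deriv g z) (at z)" if "z \<in> unit_disc" for z
    using holomorphic_derivI[OF hol open_ball that] by simp
  show "(\<lambda>n. diffs b n * z ^ n) sums deriv g z" if "z \<in> unit_disc" for z
    using g that by (intro termdiffs_sums_strong[of 1 b g]) (auto intro: deriv)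
qed

lemma norm_power_series_le:
  fixes c :: "nat \<Rightarrow> complex"
  assumes sums: "(\<lambda>n. c n * z ^ n) sums s" and z: "norm z \<le> 1"
    and M: "\<And>n. norm (c n) \<le> M n" "M sums T"
  shows "norm s \<le> T"
proof -
  have "norm (c n * z ^ n) \<le> M n" for n
    using mult_mono[OF M(1)[of n] power_le_one[of "norm z" n]] z order_trans[OF norm_ge_zero M(1)[of n]]
    by (simp add: norm_mult norm_power)
  moreover from this have "summable (\<lambda>n. norm (c n * z ^ n))"
    by (intro summable_comparison_test'[OF sums_summable[OF M(2)], of 0]) auto
  ultimately have "norm (\<Sum>n. c n * z ^ n) \<le> suminf M"
    by (intro order_trans[OF summable_norm suminf_le] sums_summable[OF M(2)])
  then show ?thesis
    using sums M(2) by (simp add: sums_iff)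
qed

text \<open>
  Put \<open>B = \<Sum> M n\<close> and \<open>C = \<Sum> (n + 1) M n\<close>. Then \<open>\<bar>g z - 1\<bar> \<le> \<bar>z\<bar> B\<close> and \<open>\<bar>g' z\<bar> \<le> C\<close>, and the hypothesis
  on the sum says \<open>C \<le> \<delta> (1 - B)\<close>. Hence
  \<open>\<bar>z g' z\<bar> \<le> \<delta> (\<bar>z\<bar> - \<bar>z\<bar> B) < \<delta> (1 - \<bar>z\<bar> B) \<le> \<delta> \<bar>g z\<bar>\<close>, where the strict inequality comes from
  \<open>\<bar>z\<bar> < 1\<close>. A majorant \<open>M\<close> replaces the coefficients so that the condition can be checked on a
  series that has a closed form.
\<close>

lemma one_plus_log_derivative_in_class_P_e:
  fixes b :: "nat \<Rightarrow> complex" and M :: "nat \<Rightarrow> real"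
  defines "\<delta> \<equiv> 1 - exp (-1)"
  assumes g: "\<And>z. z \<in> unit_disc \<Longrightarrow> (\<lambda>n. b n * z ^ n) sums g z" and b0: "b 0 = 1"
    and M: "\<And>n. norm (b (Suc n)) \<le> M n"
    and S: "(\<lambda>n. (real (Suc n) + \<delta>) * M n) sums S" "S \<le> \<delta>"
  shows "\<forall>z\<in>unit_disc. g z \<noteq> 0"
    and "(\<lambda>z. 1 + z * deriv g z / g z) \<in> class_P_e"
proof -
  have \<delta>: "0 < \<delta>" "\<delta> < 1"
    by (simp_all add: \<delta>_def)
  have M0: "0 \<le> M n" for n
    using M[of n] norm_ge_zero order_trans by blast
  have sum_nM: "summable (\<lambda>n. real (Suc n) * M n)"
    by (rule summable_comparison_test'[OF sums_summable[OF S(1)], of 0])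
       (use \<delta> M0 in \<open>auto simp: distrib_right\<close>)
  have "norm (M n) \<le> real (Suc n) * M n" for n
    using mult_right_mono[of 1 "real (Suc n)" "M n"] M0[of n] by simp
  then have sum_M: "summable M"
    by (intro summable_comparison_test'[OF sum_nM, of 0])
  define B where "B = (\<Sum>n. M n)"
  define C where "C = (\<Sum>n. real (Suc n) * M n)"
  have sums_B: "M sums B" and sums_C: "(\<lambda>n. real (Suc n) * M n) sums C"
    unfolding B_def C_def using sum_M sum_nM by (auto intro: summable_sums)
  have "(\<lambda>n. (real (Suc n) + \<delta>) * M n) sums (C + \<delta> * B)"
    using sums_add[OF sums_C sums_mult[OF sums_B, of \<delta>]] by (simp add: distrib_right)
  then have BC: "C \<le> \<delta> * (1 - B)"
    using sums_unique2[OF S(1)] S(2) by (simp add: algebra_simps)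
  have C0: "0 \<le> C"
    unfolding C_def using sum_nM M0 by (intro suminf_nonneg) auto
  have B1: "B \<le> 1"
    using BC C0 \<delta> by (smt (verit) mult_pos_neg)

  note hol_g = unit_disc_power_series(1)[OF g] and sums_dg = unit_disc_power_series(3)[OF g]
  have hol_dg: "deriv g holomorphic_on unit_disc"
    using hol_g by (intro holomorphic_deriv) auto
  have g_near_1: "norm (g z - 1) \<le> norm z * B" if z: "z \<in> unit_disc" for z
  proof (cases "z = 0")
    case True
    then show ?thesis using g[of 0] b0 sums_unique2[OF powser_sums_zero] by fastforce
  next
    case False
    \<comment> \<open>Cancelling one factor \<open>z\<close> before estimating keeps the factor \<open>norm z\<close> in the bound.\<close>
    have "(\<lambda>n. b (Suc n) * z ^ Suc n) sums (g z - 1)"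
      using g[OF z] b0 by (subst sums_Suc_iff) simp
    then have "(\<lambda>n. b (Suc n) * z ^ n) sums ((g z - 1) / z)"
      using False sums_divide[of "\<lambda>n. b (Suc n) * z ^ Suc n" "g z - 1" z] by simp
    then have "norm ((g z - 1) / z) \<le> B"
      using z M by (intro norm_power_series_le[OF _ _ _ sums_B]) auto
    then show ?thesis
      using False by (simp add: norm_divide divide_le_eq mult.commute)
  qed
  have dg_le: "norm (deriv g z) \<le> C" if z: "z \<in> unit_disc" for z
    using z M by (intro norm_power_series_le[OF sums_dg _ _ sums_C])
      (auto simp: diffs_def norm_mult mult_left_mono simp del: of_nat_Suc)
  have g_ge: "1 - norm z * B \<le> norm (g z)" if "z \<in> unit_disc" for z
    using g_near_1[OF that] norm_triangle_ineq2[of 1 "1 - g z"] by (simp add: norm_minus_commute)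
  have pos: "0 < 1 - norm z * B" if "z \<in> unit_disc" for z
    using that mult_left_mono[OF B1, of "norm z"] by auto
  show nz: "\<forall>z\<in>unit_disc. g z \<noteq> 0"
    using g_ge pos by force

  show "(\<lambda>z. 1 + z * deriv g z / g z) \<in> class_P_e"
  proof (rule class_P_eI)
    show "(\<lambda>z. 1 + z * deriv g z / g z) holomorphic_on unit_disc"
      using hol_g hol_dg nz by (intro holomorphic_intros) auto
    fix z assume z: "z \<in> unit_disc"
    have "norm (z * deriv g z) \<le> norm z * (\<delta> * (1 - B))"
      using order_trans[OF dg_le[OF z] BC] by (simp add: norm_mult mult_left_mono)
    also have "\<dots> = \<delta> * (norm z - norm z * B)"
      by (simp add: algebra_simps)
    also have "\<dots> < \<delta> * (1 - norm z * B)"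
      using z \<delta> by simp
    also have "\<dots> \<le> \<delta> * norm (g z)"
      using g_ge[OF z] \<delta> by simp
    finally show "norm (1 + z * deriv g z / g z - 1) < 1 - exp (-1)"
      using nz z by (simp add: norm_divide divide_less_eq \<delta>_def)
  qed simp
qed

lemma class_P_e_cong:
  assumes "p \<in> class_P_e" and eq: "\<And>z. z \<in> unit_disc \<Longrightarrow> p z = q z"
  shows "q \<in> class_P_e"
proof -
  have "q holomorphic_on unit_disc"
    using assms holomorphic_transform by (metis (no_types, lifting) class_P_e_def mem_Collect_eq)
  then show ?thesis
    using assms eq[of 0] by (auto simp: class_P_e_def subordinate_def)
qed

text \<open>
  Outside the unit disc, a series with these coefficients may diverge, and then \<open>suminf\<close> carries no
  meaning; so the factorization \<open>f z = z * g z\<close> is an identity on the disc.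
\<close>

context
  fixes c :: "nat \<Rightarrow> complex" and f g :: "complex \<Rightarrow> complex"
  assumes g: "\<And>z. z \<in> unit_disc \<Longrightarrow> (\<lambda>n. c n * z ^ n) sums g z"
    and f: "\<And>z. z \<in> unit_disc \<Longrightarrow> f z = z * g z"
    and c0: "c 0 = 1"
begin

lemma deriv_id_times_series: "z \<in> unit_disc \<Longrightarrow> deriv f z = g z + z * deriv g z"
proof -
  assume z: "z \<in> unit_disc"
  have "((\<lambda>z. z * g z) has_field_derivative g z + z * deriv g z) (at z)"
    by (auto intro!: derivative_eq_intros unit_disc_power_series(2)[OF g z])
  then have "(f has_field_derivative g z + z * deriv g z) (at z)"
    by (rule has_field_derivative_transform_within_open[OF _ open_ball z]) (simp add: f)
  then show ?thesis by (rule DERIV_imp_deriv)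
qed

lemma id_times_series_in_class_A: "f \<in> class_A"
proof -
  have g_0: "g 0 = 1"
    using g[of 0] powser_sums_zero[of c] c0 sums_unique2 by fastforce
  have "(\<lambda>z. z * g z) holomorphic_on unit_disc"
    using unit_disc_power_series(1)[OF g] by (intro holomorphic_intros)
  then have "f holomorphic_on unit_disc"
    using f holomorphic_transform by metis
  then show ?thesis
    using f[of 0] deriv_id_times_series[of 0] g_0 by (simp add: class_A_def)
qed

lemma exponentially_starlike_coeff_criterion:
  assumes M: "\<And>n. norm (c (Suc n)) \<le> M n"
    and S: "(\<lambda>n. (real (Suc n) + (1 - exp (-1))) * M n) sums S" "S \<le> 1 - exp (-1)"
  shows "exponentially_starlike f"
proof -
  note P = one_plus_log_derivative_in_class_P_e[OF g c0 M S]
  have "(\<lambda>z. if z = 0 then 1 else z * deriv f z / f z) \<in> class_P_e"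
    using P(1) by (intro class_P_e_cong[OF P(2)]) (auto simp: deriv_id_times_series f field_simps)
  then show ?thesis
    using id_times_series_in_class_A P(1) f by (auto simp: exponentially_starlike_def)
qed

text \<open>
  The same estimate for \<open>f'\<close> instead of \<open>g\<close>: the coefficients of \<open>f'\<close> are \<open>(n + 1) c\<^sub>n\<close>, so the
  majorant at index \<open>Suc n\<close> gains the factor \<open>n + 2\<close>.
\<close>

lemma exponentially_convex_coeff_criterion:
  assumes M: "\<And>n. norm (c (Suc n)) \<le> M n"
    and S: "(\<lambda>n. (real (Suc n) + (1 - exp (-1))) * ((real n + 2) * M n)) sums S"
      "S \<le> 1 - exp (-1)"
  shows "exponentially_convex f"
proof -
  have df: "(\<lambda>n. of_nat (Suc n) * c n * z ^ n) sums deriv f z" if z: "z \<in> unit_disc" for z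
  proof -
    have "(\<lambda>n. of_nat n * c n * z ^ (n - Suc 0)) sums deriv g z"
      using diffs_equiv[of c z] unit_disc_power_series(3)[OF g z]
      by (simp add: sums_iff)
    then have "(\<lambda>n. z * (of_nat n * c n * z ^ (n - Suc 0))) sums (z * deriv g z)"
      by (rule sums_mult)
    also have "(\<lambda>n. z * (of_nat n * c n * z ^ (n - Suc 0))) = (\<lambda>n. of_nat n * c n * z ^ n)"
      by (auto simp: fun_eq_iff power_eq_if)
    finally have "(\<lambda>n. c n * z ^ n + of_nat n * c n * z ^ n) sums deriv f z"
      unfolding deriv_id_times_series[OF z] by (rule sums_add[OF g[OF z]])
    then show ?thesis by (simp add: algebra_simps)
  qed
  have "norm (of_nat (Suc (Suc n)) * c (Suc n)) = (real n + 2) * norm (c (Suc n))" for n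
    by (simp only: norm_mult norm_of_nat) simp
  then have "norm (of_nat (Suc (Suc n)) * c (Suc n)) \<le> (real n + 2) * M n" for n
    using mult_left_mono[OF M[of n], of "real n + 2"] by simp
  note P = one_plus_log_derivative_in_class_P_e[OF df _ this S]
  show ?thesis
    using id_times_series_in_class_A P c0 by (auto simp: exponentially_convex_def)
qed

end

section \<open>The coefficients of the Le Roy type function\<close>

lemma Gamma_powr_pos:
  fixes x :: real
  assumes "x > 0"
  shows "0 < Gamma x powr \<gamma>"
  using Gamma_real_pos[OF assms] by (metis less_irrefl powr_gt_zero)

text \<open>
  The functional equation gives equality for \<open>\<alpha> = 1\<close>; beyond that, \<open>\<Gamma>\<close> increases on
  \<open>[3/2, \<infinity>)\<close>.
\<close>

lemma Gamma_add_ge_mult: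
  fixes y \<alpha> :: real
  assumes "y \<ge> 3 / 2" "\<alpha> \<ge> 1"
  shows "y * Gamma y \<le> Gamma (y + \<alpha>)"
proof -
  have "y * Gamma y = Gamma (y + 1)"
    using assms by (subst Gamma_plus1) (auto elim!: nonpos_Ints_cases)
  also have "\<dots> \<le> Gamma (y + \<alpha>)"
    using assms Gamma_real_strict_mono[of "y + 1" "y + \<alpha>"] by (cases "\<alpha> = 1") auto
  finally show ?thesis .
qed

definition le_roy_coeff :: "real \<Rightarrow> real \<Rightarrow> real \<Rightarrow> nat \<Rightarrow> real" where
  "le_roy_coeff \<alpha> \<beta> \<gamma> n = Gamma \<beta> powr \<gamma> / Gamma (\<alpha> * real n + \<beta>) powr \<gamma>"

text \<open>
  Every argument \<open>y = \<alpha> n + \<beta>\<close> with \<open>n \<ge> 1\<close> is at least \<open>4\<close>, so one step multiplies the Gamma value by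
  at least \<open>4\<close>, and its power with exponent \<open>\<gamma> \<ge> 1\<close> all the more.
\<close>

lemma le_roy_coeff_Suc_le:
  assumes "\<alpha> \<ge> 1" "\<gamma> \<ge> 1" "\<beta> > 0" "\<alpha> + \<beta> \<ge> 4"
  shows "le_roy_coeff \<alpha> \<beta> \<gamma> (Suc n) \<le> le_roy_coeff \<alpha> \<beta> \<gamma> 1 * (1 / 4) ^ n"
proof (induction n)
  case (Suc n)
  define y where "y = \<alpha> * real (Suc n) + \<beta>"
  have "\<alpha> * 1 \<le> \<alpha> * real (Suc n)"
    using assms by (intro mult_left_mono) auto
  then have y: "y \<ge> 4"
    using assms unfolding y_def by linarith
  then have G: "Gamma y > 0"
    by (intro Gamma_real_pos) auto
  have "4 * Gamma y powr \<gamma> \<le> 4 powr \<gamma> * Gamma y powr \<gamma>"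
    using powr_mono[of 1 \<gamma> 4] assms by (intro mult_right_mono) auto
  also have "\<dots> = (4 * Gamma y) powr \<gamma>"
    using G by (simp add: powr_mult)
  also have "\<dots> \<le> Gamma (y + \<alpha>) powr \<gamma>"
    using order_trans[OF mult_right_mono[OF y] Gamma_add_ge_mult] y G assms
    by (intro powr_mono2) auto
  finally have "Gamma \<beta> powr \<gamma> / Gamma (y + \<alpha>) powr \<gamma> \<le> Gamma \<beta> powr \<gamma> / (4 * Gamma y powr \<gamma>)"
    using Gamma_powr_pos y assms by (intro divide_left_mono mult_pos_pos) auto
  then have "le_roy_coeff \<alpha> \<beta> \<gamma> (Suc (Suc n)) \<le> le_roy_coeff \<alpha> \<beta> \<gamma> (Suc n) / 4"
    by (simp add: le_roy_coeff_def y_def algebra_simps)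
  with Suc show ?case by simp
qed simp

lemma le_roy_coeff_nonneg: "0 \<le> le_roy_coeff \<alpha> \<beta> \<gamma> n"
  by (simp add: le_roy_coeff_def)

lemma le_roy_coeff_0: "\<beta> > 0 \<Longrightarrow> le_roy_coeff \<alpha> \<beta> \<gamma> 0 = 1"
  using Gamma_powr_pos[of \<beta> \<gamma>] by (auto simp: le_roy_coeff_def)

lemma le_roy_power_series:
  assumes "\<alpha> \<ge> 1" "\<gamma> \<ge> 1" "\<beta> > 0" "\<alpha> + \<beta> \<ge> 4" and z: "z \<in> unit_disc"
  shows "(\<lambda>n. of_real (le_roy_coeff \<alpha> \<beta> \<gamma> n) * z ^ n) sums
           (\<Sum>n. of_real (le_roy_coeff \<alpha> \<beta> \<gamma> n) * z ^ n)"
    and "le_roy \<alpha> \<beta> \<gamma> z = z * (\<Sum>n. of_real (le_roy_coeff \<alpha> \<beta> \<gamma> n) * z ^ n)"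
proof -
  have "summable (\<lambda>n. le_roy_coeff \<alpha> \<beta> \<gamma> 1 * (1 / 4) ^ n)"
    by (intro summable_mult summable_geometric) auto
  then have "summable (\<lambda>n. of_real (le_roy_coeff \<alpha> \<beta> \<gamma> (Suc n)) * z ^ Suc n)"
  proof (rule summable_comparison_test'[where N = 0])
    fix n
    have "le_roy_coeff \<alpha> \<beta> \<gamma> (Suc n) * norm z ^ Suc n \<le> le_roy_coeff \<alpha> \<beta> \<gamma> (Suc n) * 1"
      using z by (intro mult_left_mono power_le_one le_roy_coeff_nonneg) auto
    then show "norm (of_real (le_roy_coeff \<alpha> \<beta> \<gamma> (Suc n)) * z ^ Suc n)
               \<le> le_roy_coeff \<alpha> \<beta> \<gamma> 1 * (1 / 4) ^ n"
      using le_roy_coeff_Suc_le[OF assms(1-4), of n] le_roy_coeff_nonneg[of \<alpha> \<beta> \<gamma> "Suc n"]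
      by (simp add: norm_mult norm_power del: power_Suc)
  qed
  then have summ: "summable (\<lambda>n. of_real (le_roy_coeff \<alpha> \<beta> \<gamma> n) * z ^ n)"
    by (subst (asm) summable_Suc_iff)
  then show "(\<lambda>n. of_real (le_roy_coeff \<alpha> \<beta> \<gamma> n) * z ^ n) sums
           (\<Sum>n. of_real (le_roy_coeff \<alpha> \<beta> \<gamma> n) * z ^ n)"
    by (rule summable_sums)
  have "Gamma \<beta> powr \<gamma> \<noteq> 0"
    using Gamma_powr_pos[OF assms(3), of \<gamma>] by simp
  then have "z ^ n / of_real (Gamma (\<alpha> * real n + \<beta>) powr \<gamma>) =
      of_real (le_roy_coeff \<alpha> \<beta> \<gamma> n) * z ^ n / of_real (Gamma \<beta> powr \<gamma>)" for n
    by (simp add: le_roy_coeff_def)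
  then show "le_roy \<alpha> \<beta> \<gamma> z = z * (\<Sum>n. of_real (le_roy_coeff \<alpha> \<beta> \<gamma> n) * z ^ n)"
    using \<open>Gamma \<beta> powr \<gamma> \<noteq> 0\<close> by (simp add: le_roy_def suminf_divide[OF summ])
qed

section \<open>Exponential starlikeness and convexity\<close>

lemma second_geometric_deriv_sums:
  fixes x :: real
  assumes "\<bar>x\<bar> < 1"
  shows "(\<lambda>n. (real n + 1) * (real n + 2) * x ^ n) sums (2 / (1 - x) ^ 3)"
proof -
  have "(\<lambda>n. diffs (\<lambda>n. real (Suc n)) n * x ^ n) sums (2 / (1 - x) ^ 3)"
  proof (rule termdiffs_sums_strong)
    show "(\<lambda>n. real (Suc n) * y ^ n) sums (1 / (1 - y)^2)" if "norm y < 1" for y :: real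
      using geometric_deriv_sums[OF that] .
    show "((\<lambda>y. 1 / (1 - y)^2) has_field_derivative 2 / (1 - x) ^ 3) (at x)"
    proof -
      have nz: "1 - x \<noteq> 0" using assms by auto
      have "(2 - 2 * x) / (1 - x) ^ 4 = ((1 - x) * 2) / ((1 - x) * (1 - x) ^ 3)"
        by (simp add: numeral_eq_Suc algebra_simps)
      also have "\<dots> = 2 / (1 - x) ^ 3"
        using nz by (rule mult_divide_mult_cancel_left)
      finally show ?thesis
        using nz by (auto intro!: derivative_eq_intros)
    qed
  qed (use assms in auto)
  then show ?thesis by (simp add: diffs_def algebra_simps)
qed

lemma exp_1_ge: "27 / 10 \<le> exp (1 :: real)"
  using e_approx_32 by (simp add: abs_if split: if_splits)

theorem theorem3:
  fixes \<alpha> \<beta> \<gamma> :: real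
  assumes "\<alpha> \<ge> 1" and "\<gamma> \<ge> 1" and "\<beta> > 0" and "\<alpha> + \<beta> \<ge> 4"
  shows "((2 * exp 1 - 1) * Gamma \<beta> powr \<gamma> < Gamma (\<alpha> + \<beta>) powr \<gamma> \<longrightarrow>
            exponentially_starlike (le_roy \<alpha> \<beta> \<gamma>)) \<and>
         ((4 * (exp 1)\<^sup>2 - 4 * exp 1 + 2) * Gamma \<beta> powr \<gamma>
              < (exp 1 - 1) * Gamma (\<alpha> + \<beta>) powr \<gamma> \<longrightarrow>
            exponentially_convex (le_roy \<alpha> \<beta> \<gamma>))"
proof (intro conjI impI)
  define E :: real where "E = exp 1"
  have E: "27 / 10 \<le> E"
    using exp_1_ge by (simp add: E_def)
  define \<delta> :: real where "\<delta> = 1 - exp (-1)"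
  have E\<delta>: "\<delta> = (E - 1) / E"
    by (simp add: \<delta>_def E_def exp_minus field_simps)
  define a where "a = le_roy_coeff \<alpha> \<beta> \<gamma> 1"
  have a0: "0 \<le> a"
    by (simp add: a_def le_roy_coeff_nonneg)
  have G: "0 < Gamma (\<alpha> + \<beta>) powr \<gamma>"
    using assms by (intro Gamma_powr_pos) linarith
  have a_eq: "a = Gamma \<beta> powr \<gamma> / Gamma (\<alpha> + \<beta>) powr \<gamma>"
    by (simp add: a_def le_roy_coeff_def)
  have M: "norm (of_real (le_roy_coeff \<alpha> \<beta> \<gamma> (Suc n)) :: complex) \<le> a * (1 / 4) ^ n" for n
    using le_roy_coeff_Suc_le[OF assms, of n] by (simp add: a_def le_roy_coeff_nonneg)
  have c0: "(of_real (le_roy_coeff \<alpha> \<beta> \<gamma> 0) :: complex) = 1"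
    using assms by (simp add: le_roy_coeff_0)
  note series = le_roy_power_series[OF assms]
  have geo0: "(\<lambda>n. (1 / 4 :: real) ^ n) sums (4 / 3)"
    using geometric_sums[of "1 / 4 :: real"] by simp
  have geo1: "(\<lambda>n. real (Suc n) * (1 / 4) ^ n) sums (16 / 9)"
    using geometric_deriv_sums[of "1 / 4 :: real"] by (simp add: power2_eq_square)
  have geo2: "(\<lambda>n. (real n + 1) * (real n + 2) * (1 / 4) ^ n) sums (128 / 27)"
    using second_geometric_deriv_sums[of "1 / 4"] by (simp add: power3_eq_cube)

  show "exponentially_starlike (le_roy \<alpha> \<beta> \<gamma>)"
    if "(2 * exp 1 - 1) * Gamma \<beta> powr \<gamma> < Gamma (\<alpha> + \<beta>) powr \<gamma>"
  proof (rule exponentially_starlike_coeff_criterion[OF series c0 M])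
    show "(\<lambda>n. (real (Suc n) + (1 - exp (-1))) * (a * (1 / 4) ^ n)) sums (a * (16 / 9 + \<delta> * (4 / 3)))"
      using sums_mult[OF sums_add[OF geo1 sums_mult[OF geo0, of \<delta>]], of a]
      by (simp add: \<delta>_def algebra_simps)
    \<comment> \<open>Multiplied by \<open>E\<close>, the condition \<open>a * (16 / 9 + \<delta> * (4 / 3)) \<le> \<delta>\<close> reads
        \<open>a * (28 / 9 * E - 4 / 3) \<le> E - 1\<close>.\<close>
    have "(2 * E - 1) * a < 1"
      using that G by (simp add: a_eq E_def field_simps)
    moreover have "28 / 9 * E - 4 / 3 \<le> (E - 1) * (2 * E - 1)"
    proof -
      \<comment> \<open>Splitting off the multiple of \<open>E - 27 / 10\<close> with the right leading term leaves a linear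
          remainder that is positive for \<open>E \<ge> 27 / 10\<close>.\<close>
      have "(E - 1) * (2 * E - 1) - (28 / 9 * E - 4 / 3)
            = (E - 27 / 10) * (2 * E - 1) + (13 / 45 * E - 11 / 30)"
        by (simp add: field_simps)
      moreover have "0 \<le> (E - 27 / 10) * (2 * E - 1)" using E by simp
      ultimately show ?thesis using E by linarith
    qed
    ultimately have "a * (28 / 9 * E - 4 / 3) \<le> (E - 1)"
      using mult_left_mono[OF _ a0, of "28 / 9 * E - 4 / 3" "(E - 1) * (2 * E - 1)"]
        mult_strict_left_mono[of "(2 * E - 1) * a" 1 "E - 1"] E by (simp add: algebra_simps)
    then have "a * (28 / 9 * E - 4 / 3) / E \<le> \<delta>"
      using E by (simp add: E\<delta> divide_right_mono)
    moreover have "a * (16 / 9 + \<delta> * (4 / 3)) = a * (28 / 9 * E - 4 / 3) / E"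
      using E by (simp add: E\<delta> field_simps)
    ultimately show "a * (16 / 9 + \<delta> * (4 / 3)) \<le> 1 - exp (-1)"
      by (simp add: \<delta>_def)
  qed

  show "exponentially_convex (le_roy \<alpha> \<beta> \<gamma>)"
    if "(4 * (exp 1)\<^sup>2 - 4 * exp 1 + 2) * Gamma \<beta> powr \<gamma> < (exp 1 - 1) * Gamma (\<alpha> + \<beta>) powr \<gamma>"
  proof (rule exponentially_convex_coeff_criterion[OF series c0 M])
    show "(\<lambda>n. (real (Suc n) + (1 - exp (-1))) * ((real n + 2) * (a * (1 / 4) ^ n)))
            sums (a * (128 / 27 + \<delta> * (16 / 9 + 4 / 3)))"
      using sums_mult[OF sums_add[OF geo2 sums_mult[OF sums_add[OF geo1 geo0], of \<delta>]], of a]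
      by (simp add: \<delta>_def algebra_simps)
    \<comment> \<open>Multiplied by \<open>E\<close>, the condition \<open>a * (128 / 27 + \<delta> * (16 / 9 + 4 / 3)) \<le> \<delta>\<close> reads
        \<open>(212 / 27 * E - 28 / 9) * a \<le> E - 1\<close>.\<close>
    have "(4 * E\<^sup>2 - 4 * E + 2) * a < E - 1"
      using that G by (simp add: a_eq E_def field_simps)
    moreover have "212 / 27 * E - 28 / 9 \<le> 4 * E\<^sup>2 - 4 * E + 2"
    proof -
      have "4 * E\<^sup>2 - 4 * E + 2 - (212 / 27 * E - 28 / 9)
            = (E - 27 / 10) * (4 * E - 2) + (128 / 135 * E - 13 / 45)"
        by (simp add: field_simps power2_eq_square)
      moreover have "0 \<le> (E - 27 / 10) * (4 * E - 2)" using E by simp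
      ultimately show ?thesis using E by linarith
    qed
    ultimately have "(212 / 27 * E - 28 / 9) * a \<le> E - 1"
      using mult_right_mono[OF _ a0] by fastforce
    then have "(212 / 27 * E - 28 / 9) * a / E \<le> \<delta>"
      using E by (simp add: E\<delta> divide_right_mono)
    moreover have "a * (128 / 27 + \<delta> * (16 / 9 + 4 / 3)) = (212 / 27 * E - 28 / 9) * a / E"
      using E by (simp add: E\<delta> field_simps)
    ultimately show "a * (128 / 27 + \<delta> * (16 / 9 + 4 / 3)) \<le> 1 - exp (-1)"
      by (simp add: \<delta>_def)
  qed
qed

end
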